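(* Let $n>5$ be prime, and let $v(t)$ be the random walk on $\mathbb{Z}_n$ whose step distribution is uniform over a finite multiset $\Gamma$ of elements of $\mathbb{Z}_n$. If the drift $D(\Gamma)=\sum_{k\in\Gamma}k$ (sum with multiplicity, computed in $\mathbb{Z}_n$) is nonzero, then $v(t)$ is reconstructive.
   Context: The step distribution uniform over the multiset $\Gamma$ assigns to $k$ the probability (multiplicity of $k$ in $\Gamma$)/$|\Gamma|$. The random walk $v(t)$ has $v(1)$ uniform on $\mathbb{Z}_n$ and independent steps with this distribution. A labeling is $f:\mathbb{Z}_n\to\{0,1\}$. The walk is reconstructive if, for any two labelings $f_1,f_2$, the distributions of $\{f_1(v(t))\}_{t\ge1}$ and $\{f_2(v(t))\}_{t\ge1}$ coincide only if there is $\ell\in\mathbb{Z}_n$ with $f_1(k)=f_2(k+\ell)$ for all $k$. *)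

theory Defs
  imports Complex_Main "HOL-Library.Multiset" "HOL-Computational_Algebra.Primes"
begin

text \<open>Z_n is represented by {0..<n} (nat) with addition mod n. The step multiset
Gamma is a multiset of naturals below n. A labeling is f :: nat => bool
(only its values on {0..<n} matter).\<close>

definition step_prob :: "nat multiset \<Rightarrow> nat \<Rightarrow> real" where
  "step_prob \<Gamma> k = real (count \<Gamma> k) / real (size \<Gamma>)"

text \<open>path_prob n Gamma f v w: probability that, starting the walk at v (time 1),
the observed labels at times 1..length w equal w.\<close>
fun path_prob :: "nat \<Rightarrow> nat multiset \<Rightarrow> (nat \<Rightarrow> bool) \<Rightarrow> nat \<Rightarrow> bool list \<Rightarrow> real" where
  "path_prob n \<Gamma> f v [] = 1"
| "path_prob n \<Gamma> f v [b] = (if f v = b then 1 else 0)"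
| "path_prob n \<Gamma> f v (b # b' # bs) =
     (if f v = b then 1 else 0) *
     (\<Sum>k\<in>set_mset \<Gamma>. step_prob \<Gamma> k * path_prob n \<Gamma> f ((v + k) mod n) (b' # bs))"

text \<open>Finite-dimensional distribution of the label process f(v(1)), f(v(2)), ...
with v(1) uniform on Z_n: probability that the first length w labels equal w.\<close>
definition word_prob :: "nat \<Rightarrow> nat multiset \<Rightarrow> (nat \<Rightarrow> bool) \<Rightarrow> bool list \<Rightarrow> real" where
  "word_prob n \<Gamma> f w = (\<Sum>v<n. path_prob n \<Gamma> f v w / real n)"

definition same_label_distribution ::
  "nat \<Rightarrow> nat multiset \<Rightarrow> (nat \<Rightarrow> bool) \<Rightarrow> (nat \<Rightarrow> bool) \<Rightarrow> bool" where
  "same_label_distribution n \<Gamma> f1 f2 \<longleftrightarrow> (\<forall>w. word_prob n \<Gamma> f1 w = word_prob n \<Gamma> f2 w)"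

definition reconstructive :: "nat \<Rightarrow> nat multiset \<Rightarrow> bool" where
  "reconstructive n \<Gamma> \<longleftrightarrow>
     (\<forall>f1 f2 :: nat \<Rightarrow> bool. same_label_distribution n \<Gamma> f1 f2 \<longrightarrow>
        (\<exists>l<n. \<forall>k<n. f1 k = f2 ((k + l) mod n)))"

definition drift :: "nat \<Rightarrow> nat multiset \<Rightarrow> nat" where
  "drift n \<Gamma> = sum_mset \<Gamma> mod n"

end

theory Submission
  imports Defs "HOL-Number_Theory.Residues" "HOL-Computational_Algebra.Polynomial"
begin

text \<open>Let \<open>\<omega>\<close> be a primitive \<open>n\<close>-th root of unity. The characters \<open>v \<mapsto> \<omega>^(x v)\<close> diagonalise the
  transition operator \<open>T\<close> of the walk. The only arithmetic input is that an integer polynomial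
  vanishing at \<open>\<omega>\<close> takes a value divisible by \<open>n\<close> at \<open>1\<close>; it shows that a nonzero drift makes the
  eigenvalues of \<open>T\<close> distinct and that a nonconstant labeling has no vanishing Fourier coefficient.
  The law of the labels determines the correlations \<open>\<Sum>v. f(v) T^t (f T^s f)(v)\<close> for all \<open>s\<close> and \<open>t\<close>,
  hence, the eigenvalues being distinct, the bispectrum \<open>a(y) a(z) cnj (a(y + z))\<close> of \<open>f\<close>. Two
  nonconstant labelings with the same bispectrum have Fourier coefficients whose ratio is a
  character, so they are shifts of each other.\<close>

section \<open>Integer polynomials at roots of unity\<close>

lemma int_matrix_kernel_trivial:
  fixes p :: int and B :: "nat \<Rightarrow> nat \<Rightarrow> int" and x :: "nat \<Rightarrow> 'a :: {ring_char_0, idom}"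
  assumes p: "prime p"
    and "\<And>i. i < N \<Longrightarrow> \<not> p dvd B i i"
    and "\<And>i j. i < N \<Longrightarrow> j < N \<Longrightarrow> i \<noteq> j \<Longrightarrow> p dvd B i j"
    and "\<And>i. i < N \<Longrightarrow> (\<Sum>j<N. of_int (B i j) * x j) = 0"
    and "i < N"
  shows "x i = 0"
  using assms(2-)
proof (induction N arbitrary: B i)
  case (Suc N)
  define C where "C i j = B N N * B i j - B i N * B N j" for i j
  have last: "of_int (B N N) * x N = - (\<Sum>j<N. of_int (B N j) * x j)"
    using Suc.prems(3)[of N] by (simp add: add_eq_0_iff2)
  have below: "x k = 0" if "k < N" for k
  proof (rule Suc.IH[of C])
    fix i assume i: "i < N"
    have "p dvd B i N * B N i" using Suc.prems(2)[of i N] i by simp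
    moreover have "\<not> p dvd B N N * B i i"
      using Suc.prems(1)[of N] Suc.prems(1)[of i] i p by (simp add: prime_dvd_mult_iff)
    ultimately show "\<not> p dvd C i i" unfolding C_def by (metis diff_add_cancel dvd_add)
  next
    fix i j assume "i < N" "j < N" "i \<noteq> j"
    thus "p dvd C i j" unfolding C_def
      using Suc.prems(2)[of i j] Suc.prems(2)[of i N] by (simp add: dvd_diff)
  next
    fix i assume i: "i < N"
    have "(\<Sum>j<N. of_int (C i j) * x j) =
        of_int (B N N) * (\<Sum>j<N. of_int (B i j) * x j) - of_int (B i N) * (\<Sum>j<N. of_int (B N j) * x j)"
      by (simp add: C_def sum_distrib_left sum_subtractf algebra_simps)
    also have "\<dots> = of_int (B N N) * (\<Sum>j<N. of_int (B i j) * x j) + of_int (B i N) * (of_int (B N N) * x N)"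
      by (simp add: last)
    also have "\<dots> = of_int (B N N) * (\<Sum>j<Suc N. of_int (B i j) * x j)"
      by (simp add: algebra_simps)
    finally show "(\<Sum>j<N. of_int (C i j) * x j) = 0"
      using Suc.prems(3)[of i] i by simp
  qed (use that in simp)
  have "x N = 0"
  proof -
    have "of_int (B N N) * x N = 0" using last below by simp
    moreover have "B N N \<noteq> 0" using Suc.prems(1)[of N] by auto
    ultimately show ?thesis by simp
  qed
  thus ?case using below Suc.prems(4) by (cases "i = N") auto
qed simp

text \<open>Integer polynomials are kept inside \<open>complex poly\<close> so that they can be
  evaluated at a root of unity without a coercion.\<close>

definition int_coeffs :: "complex poly \<Rightarrow> bool" where
  "int_coeffs p \<longleftrightarrow> (\<forall>i. coeff p i \<in> \<int>)"

lemma int_coeffs_0 [simp]: "int_coeffs 0"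
  and int_coeffs_add: "int_coeffs p \<Longrightarrow> int_coeffs q \<Longrightarrow> int_coeffs (p + q)"
  and int_coeffs_diff: "int_coeffs p \<Longrightarrow> int_coeffs q \<Longrightarrow> int_coeffs (p - q)"
  and int_coeffs_mult: "int_coeffs p \<Longrightarrow> int_coeffs q \<Longrightarrow> int_coeffs (p * q)"
  and int_coeffs_monom: "c \<in> \<int> \<Longrightarrow> int_coeffs (monom c k)"
  and int_coeffs_pCons: "int_coeffs (pCons c p) \<longleftrightarrow> c \<in> \<int> \<and> int_coeffs p"
  by (auto simp: int_coeffs_def coeff_mult coeff_pCons split: nat.splits)

lemma int_coeffs_smult: "c \<in> \<int> \<Longrightarrow> int_coeffs p \<Longrightarrow> int_coeffs (smult c p)"
  by (simp add: int_coeffs_def)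

lemma int_coeffs_sum: "(\<And>i. i \<in> A \<Longrightarrow> int_coeffs (p i)) \<Longrightarrow> int_coeffs (sum p A)"
  by (auto simp: int_coeffs_def coeff_sum intro!: Ints_sum)

lemma int_coeffs_power: "int_coeffs p \<Longrightarrow> int_coeffs (p ^ k)"
  by (induction k) (auto simp: int_coeffs_mult int_coeffs_pCons one_pCons)

text \<open>Congruence modulo \<open>n\<close> is expressed by an explicit integral remainder
  \<open>r\<close>, which survives evaluation at a root of unity. The inner binomial coefficients
  are divisible by the prime \<open>n\<close>.\<close>

lemma freshmans_dream_int_coeffs:
  assumes "prime n" "int_coeffs p" "int_coeffs q"
  shows "\<exists>r. int_coeffs r \<and> (p + q) ^ n = p ^ n + q ^ n + of_nat n * r"
proof -
  have n: "n > 0" "n \<noteq> 0" using assms(1) by (auto simp: prime_gt_0_nat)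
  define r where "r = (\<Sum>k\<in>{0<..<n}. of_nat ((n choose k) div n) * p ^ k * q ^ (n - k))"
  have "(p + q) ^ n = (\<Sum>k\<le>n. of_nat (n choose k) * p ^ k * q ^ (n - k))"
    by (rule binomial_ring)
  also have "{..n} = insert 0 (insert n {0<..<n})" using n by auto
  also have "(\<Sum>k\<in>insert 0 (insert n {0<..<n}). of_nat (n choose k) * p ^ k * q ^ (n - k)) =
      p ^ n + q ^ n + (\<Sum>k\<in>{0<..<n}. of_nat (n choose k) * p ^ k * q ^ (n - k))"
    using n by (simp add: algebra_simps)
  also have "(\<Sum>k\<in>{0<..<n}. of_nat (n choose k) * p ^ k * q ^ (n - k)) = of_nat n * r"
    unfolding r_def sum_distrib_left
  proof (rule sum.cong)
    fix k assume k: "k \<in> {0<..<n}"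
    have "n dvd n choose k" using k assms(1) by (intro dvd_choose_prime) auto
    hence "n choose k = n * ((n choose k) div n)" by simp
    hence "(of_nat (n choose k) :: complex poly) = of_nat (n * ((n choose k) div n))" by (rule arg_cong)
    hence "of_nat (n choose k) = (of_nat n * of_nat ((n choose k) div n) :: complex poly)"
      by (simp only: of_nat_mult)
    thus "of_nat (n choose k) * p ^ k * q ^ (n - k) = of_nat n * (of_nat ((n choose k) div n) * p ^ k * q ^ (n - k))"
      by (simp add: mult.assoc)
  qed simp
  moreover have "int_coeffs (of_nat m)" for m
    by (simp add: of_nat_poly int_coeffs_pCons)
  hence "int_coeffs r" unfolding r_def
    by (intro int_coeffs_sum int_coeffs_mult int_coeffs_power assms)
  ultimately show ?thesis by auto
qed

lemma fermat_int:
  assumes "prime n"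
  shows "int n dvd c ^ n - c"
proof -
  define a where "a = nat (c mod int n)"
  have n: "n > 0" using assms by (simp add: prime_gt_0_nat)
  have "[a ^ n = a] (mod n)"
  proof (cases "n dvd a")
    case True
    thus ?thesis using n by (simp add: cong_def dvd_power dvd_imp_mod_0 dvd_trans)
  next
    case False
    have "[a * a ^ (n - 1) = a * 1] (mod n)"
      by (intro cong_scalar_left fermat_theorem assms False)
    thus ?thesis using n by (simp flip: power_Suc)
  qed
  hence "[int a ^ n = int a] (mod int n)" by (metis cong_int_iff of_nat_power)
  moreover have "[c = int a] (mod int n)" using n by (simp add: a_def cong_def)
  ultimately have "[c ^ n = c] (mod int n)" by (meson cong_pow cong_sym cong_trans)
  thus ?thesis by (simp add: cong_iff_dvd_diff)
qed

text \<open>Modulo \<open>n\<close> the \<open>n\<close>-th power is additive and fixes integers,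
  and it sends \<open>\<omega>\<close> to 1. Induction on the coefficient list splits off one
  constant term at a time.\<close>

lemma int_coeffs_frobenius:
  assumes "prime n" "\<omega> ^ n = 1" "int_coeffs p"
  shows "\<exists>r. int_coeffs r \<and> poly p \<omega> ^ n = poly p 1 + of_nat n * poly r \<omega>"
  using assms(3)
proof (induction p)
  case 0
  thus ?case using assms(1) by (intro exI[of _ 0]) (auto simp: prime_gt_0_nat)
next
  case (pCons c p)
  then obtain r where r: "int_coeffs r" "poly p \<omega> ^ n = poly p 1 + of_nat n * poly r \<omega>"
    by (auto simp: int_coeffs_pCons)
  obtain m where m: "c = of_int m" using pCons by (auto simp: int_coeffs_pCons elim: Ints_cases)
  obtain d where "m ^ n - m = int n * d" using fermat_int[OF assms(1), of m] by (auto simp: dvd_def)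
  hence "m ^ n = m + int n * d" by simp
  hence d: "c ^ n = c + of_nat n * of_int d"
    unfolding m by (metis of_int_add of_int_mult of_int_of_nat_eq of_int_power)
  obtain s where s: "int_coeffs s" "([:c:] + pCons 0 p) ^ n = [:c:] ^ n + pCons 0 p ^ n + of_nat n * s"
    using freshmans_dream_int_coeffs[OF assms(1), of "[:c:]" "pCons 0 p"] pCons
    by (auto simp: int_coeffs_pCons)
  have "poly (pCons c p) \<omega> ^ n = poly (([:c:] + pCons 0 p) ^ n) \<omega>"
    by simp
  also have "\<dots> = c ^ n + poly p \<omega> ^ n + of_nat n * poly s \<omega>"
    unfolding s(2) by (simp add: power_mult_distrib assms(2))
  also have "\<dots> = poly (pCons c p) 1 + of_nat n * poly ([:of_int d:] + r + s) \<omega>"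
    by (simp add: d r(2) algebra_simps)
  finally show ?case using r(1) s(1)
    by (intro exI[of _ "[:of_int d:] + r + s"]) (auto simp: int_coeffs_add int_coeffs_pCons)
qed

lemma root_of_unity_power_mod:
  fixes z :: "'a :: monoid_mult"
  assumes "z ^ n = 1"
  shows "z ^ (k mod n) = z ^ k"
proof -
  have "z ^ k = z ^ (n * (k div n) + k mod n)" by simp
  also have "\<dots> = z ^ (k mod n)" unfolding power_add power_mult assms by simp
  finally show ?thesis ..
qed

text \<open>Finitely many powers of \<open>\<omega>\<close> generate its ring of integer polynomial
  values additively: coefficients are collected by exponent modulo \<open>n\<close>. They supply the
  rows of an integer matrix.\<close>

lemma int_coeffs_poly_root_of_unity:
  assumes "n > 0" "\<omega> ^ n = 1" "int_coeffs p"
  shows "\<exists>c. poly p \<omega> = (\<Sum>j<n. of_int (c j) * \<omega> ^ j)"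
proof -
  have "\<forall>i. \<exists>b. coeff p i = of_int b"
    using assms(3) by (auto simp: int_coeffs_def elim: Ints_cases)
  then obtain b where b: "\<And>i. coeff p i = of_int (b i)" by metis
  define c where "c j = (\<Sum>i | i \<in> {..degree p} \<and> i mod n = j. b i)" for j
  have "poly p \<omega> = (\<Sum>i\<le>degree p. of_int (b i) * \<omega> ^ i)"
    by (simp add: poly_altdef b)
  also have "\<dots> = (\<Sum>j<n. \<Sum>i | i \<in> {..degree p} \<and> i mod n = j. of_int (b i) * \<omega> ^ i)"
    by (rule sum.group[symmetric]) (use assms(1) in auto)
  also have "\<dots> = (\<Sum>j<n. of_int (c j) * \<omega> ^ j)"
    unfolding c_def of_int_sum sum_distrib_right
    by (intro sum.cong refl) (auto simp: root_of_unity_power_mod[OF assms(2)])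
  finally show ?thesis by blast
qed

text \<open>By Frobenius, \<open>0 = p(\<omega>)^n\<close> is congruent to \<open>p(1)\<close> modulo \<open>n \<int>[\<omega>]\<close>. Written out on the
  powers of \<open>\<omega>\<close>, this puts the vector \<open>(\<omega>^i)\<close> into the kernel of an integer matrix that is
  congruent to \<open>p(1)\<close> times the identity modulo \<open>n\<close>.\<close>
lemma prime_dvd_poly_1_if_root_of_unity:
  assumes n: "prime n" and \<omega>: "\<omega> ^ n = 1" and p: "int_coeffs p" "poly p \<omega> = 0"
    and m: "poly p 1 = of_int m"
  shows "int n dvd m"
proof (rule ccontr)
  assume ndvd: "\<not> int n dvd m"
  have n0: "n > 0" using n by (simp add: prime_gt_0_nat)
  obtain r where r: "int_coeffs r" "poly p \<omega> ^ n = poly p 1 + of_nat n * poly r \<omega>"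
    using int_coeffs_frobenius[OF n \<omega> p(1)] by blast
  hence eq: "of_int m = - of_nat n * poly r \<omega>" using p(2) m n0 by (simp add: eq_neg_iff_add_eq_0 zero_power)
  have "\<exists>c. poly (monom 1 i * r) \<omega> = (\<Sum>j<n. of_int (c j) * \<omega> ^ j)" for i
    using r(1) by (intro int_coeffs_poly_root_of_unity n0 \<omega> int_coeffs_mult int_coeffs_monom) auto
  then obtain c where c: "\<And>i. \<omega> ^ i * poly r \<omega> = (\<Sum>j<n. of_int (c i j) * \<omega> ^ j)"
    by (simp add: poly_monom) metis
  define B where "B i j = (if i = j then m else 0) + int n * c i j" for i j
  \<comment> \<open>The entry of the kernel vector at index 0 is 1, so its vanishing is the
    contradiction.\<close>
  have "\<omega> ^ 0 = 0"
  proof (rule int_matrix_kernel_trivial[of "int n" n B])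
    fix i assume i: "i < n"
    have "(\<Sum>j<n. of_int (B i j) * \<omega> ^ j) =
        (\<Sum>j<n. if i = j then of_int m * \<omega> ^ j else 0) + of_nat n * (\<Sum>j<n. of_int (c i j) * \<omega> ^ j)"
      unfolding sum_distrib_left sum.distrib[symmetric]
      by (intro sum.cong) (auto simp: B_def algebra_simps)
    also have "\<dots> = of_int m * \<omega> ^ i + of_nat n * (\<omega> ^ i * poly r \<omega>)"
      using i by (simp add: c)
    also have "\<dots> = 0" by (simp add: eq)
    finally show "(\<Sum>j<n. of_int (B i j) * \<omega> ^ j) = 0" .
  next
    fix i assume "i < n"
    show "\<not> int n dvd B i i" using ndvd by (simp add: B_def dvd_add_left_iff)
  qed (use n n0 in \<open>auto simp: B_def\<close>)
  thus False by simp
qed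

text \<open>A polynomial \<open>q\<close> that vanishes at every node except \<open>g y\<close>
  turns the vanishing power moments into the single term at \<open>y\<close>.\<close>

lemma vandermonde_kernel_trivial:
  fixes g c :: "'a \<Rightarrow> 'b :: field"
  assumes "finite A" "inj_on g A" and zero: "\<And>t::nat. (\<Sum>x\<in>A. c x * g x ^ t) = 0" and "y \<in> A"
  shows "c y = 0"
proof -
  define q where "q = (\<Prod>x\<in>A - {y}. [:- g x, 1:])"
  have q: "poly q (g x) = 0 \<longleftrightarrow> x \<noteq> y" if "x \<in> A" for x
    using assms(1,2,4) that by (auto simp: q_def poly_prod inj_on_def)
  have "(\<Sum>x\<in>A. c x * poly q (g x)) = (\<Sum>i\<le>degree q. coeff q i * (\<Sum>x\<in>A. c x * g x ^ i))"
    unfolding poly_altdef sum_distrib_left by (subst sum.swap) (simp add: mult_ac)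
  hence "(\<Sum>x\<in>A. c x * poly q (g x)) = 0" by (simp add: zero)
  moreover have "(\<Sum>x\<in>A. c x * poly q (g x)) = c y * poly q (g y)"
    using assms(1,4) q by (subst sum.remove[of _ y]) (auto intro!: sum.neutral)
  ultimately show ?thesis using q[OF assms(4)] by simp
qed

section \<open>Fourier coefficients of labelings\<close>

definition unity_root :: "nat \<Rightarrow> complex" where
  "unity_root n = cis (2 * pi / real n)"

lemma unity_root_power: "unity_root n ^ k = cis (2 * pi * real k / real n)"
  by (simp add: unity_root_def DeMoivre mult_ac)

lemma unity_root_power_n [simp]: "n > 0 \<Longrightarrow> unity_root n ^ n = 1"
  by (simp add: unity_root_power)

lemma cnj_unity_root_power_n: "n > 0 \<Longrightarrow> cnj (unity_root n) ^ n = 1"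
  by (simp flip: complex_cnj_power)

lemma cnj_unity_root_power [simp]: "cnj (unity_root n) ^ k * unity_root n ^ k = 1"
    "unity_root n ^ k * cnj (unity_root n) ^ k = 1"
  by (simp_all add: unity_root_def cis_cnj cis_mult flip: power_mult_distrib)

lemma unity_root_power_mod: "n > 0 \<Longrightarrow> unity_root n ^ (k mod n) = unity_root n ^ k"
  by (simp add: root_of_unity_power_mod)

lemma unity_root_power_cong:
  assumes "n > 0" "i mod n = j mod n" shows "unity_root n ^ i = unity_root n ^ j"
  by (metis assms unity_root_power_mod)

lemma inj_on_unity_root_power: "n > 0 \<Longrightarrow> inj_on (\<lambda>k. unity_root n ^ k) {..<n}"
  using bij_betw_imp_inj_on[OF bij_betw_roots_unity[of n]] by (simp add: unity_root_power)

lemma unity_root_power_eq_iff: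
  assumes "n > 0" shows "unity_root n ^ i = unity_root n ^ j \<longleftrightarrow> i mod n = j mod n"
  using inj_onD[OF inj_on_unity_root_power[OF assms], of "i mod n" "j mod n"] assms
  by (auto simp: unity_root_power_mod intro: unity_root_power_cong)

lemma root_of_unity_cases:
  assumes "n > 0" "z ^ n = 1" obtains l where "l < n" "z = unity_root n ^ l"
  using bij_betw_imp_surj_on[OF bij_betw_roots_unity[OF assms(1)]] assms
  by (auto simp: unity_root_power set_eq_iff image_iff)

lemma sum_unity_root_orthogonal:
  assumes n: "n > 0"
  shows "(\<Sum>x<n. unity_root n ^ (x * v) * cnj (unity_root n) ^ (x * k)) =
    (if v mod n = k mod n then of_nat n else 0)"
proof -
  \<comment> \<open>Conjugate powers stand for negative exponents; \<open>z\<close> is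
    \<open>\<omega>\<close> to the power \<open>v - k\<close>, and the sum is geometric in
    \<open>z\<close>.\<close>
  define z where "z = unity_root n ^ v * cnj (unity_root n) ^ k"
  have "unity_root n ^ k \<noteq> 0" by (simp add: unity_root_def)
  hence "z = 1 \<longleftrightarrow> z * unity_root n ^ k = 1 * unity_root n ^ k" by (simp only: mult_cancel_right simp_thms)
  also have "\<dots> \<longleftrightarrow> unity_root n ^ v = unity_root n ^ k" by (simp add: z_def mult.assoc)
  finally have z1: "z = 1 \<longleftrightarrow> v mod n = k mod n" by (simp add: unity_root_power_eq_iff[OF n])
  have "z ^ n = (unity_root n ^ v) ^ n * (cnj (unity_root n) ^ k) ^ n"
    by (simp add: z_def power_mult_distrib)
  also have "\<dots> = (unity_root n ^ n) ^ v * (cnj (unity_root n) ^ n) ^ k"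
    by (simp only: mult.commute flip: power_mult)
  finally have zn: "z ^ n = 1" using n by (simp add: cnj_unity_root_power_n)
  have "(\<Sum>x<n. unity_root n ^ (x * v) * cnj (unity_root n) ^ (x * k)) = (\<Sum>x<n. z ^ x)"
    by (intro sum.cong) (simp_all add: z_def power_mult_distrib mult.commute flip: power_mult)
  also have "\<dots> = (if v mod n = k mod n then of_nat n else 0)"
    using z1 zn by (simp add: sum_gp_strict)
  finally show ?thesis .
qed

text \<open>With the factor \<open>1 / n\<close> placed here, inversion needs no factor and the
  coefficient at 0 is the mean of the labeling.\<close>

definition fourier_coeff :: "nat \<Rightarrow> (nat \<Rightarrow> bool) \<Rightarrow> nat \<Rightarrow> complex" where
  "fourier_coeff n f x = (\<Sum>k<n. of_bool (f k) * cnj (unity_root n) ^ (x * k)) / of_nat n"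

lemma fourier_inversion:
  assumes n: "n > 0"
  shows "of_bool (f (v mod n)) = (\<Sum>x<n. fourier_coeff n f x * unity_root n ^ (x * v))"
proof -
  have "(\<Sum>x<n. fourier_coeff n f x * unity_root n ^ (x * v)) =
     (\<Sum>k<n. of_bool (f k) * (\<Sum>x<n. unity_root n ^ (x * v) * cnj (unity_root n) ^ (x * k)) / of_nat n)"
    unfolding fourier_coeff_def sum_divide_distrib sum_distrib_left sum_distrib_right
    by (subst sum.swap) (simp add: field_simps)
  also have "\<dots> = (\<Sum>k<n. if k = v mod n then of_bool (f k) else 0)"
    using n by (intro sum.cong refl) (auto simp: sum_unity_root_orthogonal)
  also have "\<dots> = of_bool (f (v mod n))" using n by simp
  finally show ?thesis ..
qed

lemma fourier_coeff_mod:
  assumes "n > 0" shows "fourier_coeff n f (x mod n) = fourier_coeff n f x"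
proof -
  have "cnj (unity_root n ^ (x mod n * k)) = cnj (unity_root n ^ (x * k))" for k
    by (subst unity_root_power_cong[OF assms, of "x mod n * k" "x * k"]) (auto simp: mod_mult_left_eq)
  thus ?thesis by (simp add: fourier_coeff_def)
qed

lemma fourier_coeff_0: "fourier_coeff n f 0 = of_real (real (card {k. k < n \<and> f k}) / real n)"
proof -
  have "(\<Sum>k<n. of_bool (f k) :: complex) = of_nat (card {k. k < n \<and> f k})"
    by (simp add: of_bool_def sum.If_cases Int_def)
  thus ?thesis by (simp add: fourier_coeff_def)
qed

text \<open>Up to the factor \<open>1 / n\<close>, the coefficient is an integer polynomial at a
  root of unity whose value at 1 is the number of true labels. If it vanishes, \<open>n\<close>
  divides this number, which lies between 0 and \<open>n\<close>.\<close>

lemma fourier_coeff_eq_0_imp_constant: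
  assumes n: "prime n" and zero: "fourier_coeff n f x = 0"
  shows "(\<forall>k<n. f k) \<or> (\<forall>k<n. \<not> f k)"
proof -
  define A where "A = {k. k < n \<and> f k}"
  have A: "finite A" "A \<subseteq> {..<n}" by (auto simp: A_def)
  have n0: "n > 0" using n by (simp add: prime_gt_0_nat)
  define p where "p = (\<Sum>k\<in>A. monom (1::complex) (x * k))"
  have "(\<Sum>k<n. of_bool (f k) * cnj (unity_root n) ^ (x * k)) = 0"
    using zero n0 by (simp add: fourier_coeff_def)
  also have "(\<Sum>k<n. of_bool (f k) * cnj (unity_root n) ^ (x * k)) = poly p (cnj (unity_root n))"
    unfolding p_def poly_sum poly_monom
    by (rule sum.mono_neutral_cong_right) (auto simp: A_def)
  finally have "poly p (cnj (unity_root n)) = 0" .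
  moreover have "int_coeffs p" by (auto simp: p_def intro!: int_coeffs_sum int_coeffs_monom)
  moreover have "poly p 1 = of_int (int (card A))" by (simp add: p_def poly_sum poly_monom)
  ultimately have "int n dvd int (card A)"
    using prime_dvd_poly_1_if_root_of_unity[OF n cnj_unity_root_power_n[OF n0]] by blast
  hence dvd: "n dvd card A" by simp
  show ?thesis
  proof (cases "card A = 0")
    case True
    thus ?thesis using A by (auto simp: A_def)
  next
    case False
    hence "card A = n" using dvd card_mono[OF _ A(2)] by (auto dest: dvd_imp_le)
    hence "A = {..<n}" using A(2) by (intro card_subset_eq) auto
    thus ?thesis by (auto simp: A_def)
  qed
qed

section \<open>Correlations along the walk\<close>

definition step_eigenvalue :: "nat \<Rightarrow> nat multiset \<Rightarrow> nat \<Rightarrow> complex" where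
  "step_eigenvalue n \<Gamma> x = (\<Sum>k\<in>set_mset \<Gamma>. of_real (step_prob \<Gamma> k) * unity_root n ^ (x * k))"

lemma step_eigenvalue_cong:
  assumes "n > 0" "x mod n = y mod n" shows "step_eigenvalue n \<Gamma> x = step_eigenvalue n \<Gamma> y"
proof -
  have "unity_root n ^ (x * k) = unity_root n ^ (y * k)" for k
    using assms by (intro unity_root_power_cong) (auto intro: mod_mult_cong)
  thus ?thesis by (simp add: step_eigenvalue_def)
qed

lemma sum_mset_nat_eq: "sum_mset \<Gamma> = (\<Sum>k\<in>set_mset \<Gamma>. count \<Gamma> k * k)" for \<Gamma> :: "nat multiset"
proof -
  have "sum_mset M = (\<Sum>k\<in>A. count M k * k)" if "finite A" "set_mset M \<subseteq> A" for A and M :: "nat multiset"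
    using that(2)
  proof (induction M)
    case (add x M)
    have "(\<Sum>k\<in>A. count (add_mset x M) k * k) = (\<Sum>k\<in>A. (if k = x then x else 0) + count M k * k)"
      by (intro sum.cong) auto
    also have "\<dots> = x + (\<Sum>k\<in>A. count M k * k)" using add.prems that(1) by (simp add: sum.distrib)
    finally show ?case using add by simp
  qed simp
  thus ?thesis by blast
qed

text \<open>If two eigenvalues agree, the quotient by \<open>X - 1\<close> of the integer polynomial
  \<open>\<Sum>k. count \<Gamma> k (X^(x k) - X^(y k))\<close> vanishes at the root of unity; its value at \<open>1\<close> is
  \<open>(x - y) D(\<Gamma>)\<close>.\<close>
lemma inj_on_step_eigenvalue:
  assumes n: "prime n" and drift: "drift n \<Gamma> \<noteq> 0"
  shows "inj_on (step_eigenvalue n \<Gamma>) {..<n}"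
proof (rule inj_onI)
  fix x y assume xy: "x \<in> {..<n}" "y \<in> {..<n}" and eq: "step_eigenvalue n \<Gamma> x = step_eigenvalue n \<Gamma> y"
  have n0: "n > 0" and n1: "n > 1" using prime_gt_1_nat[OF n] by auto
  define \<omega> where "\<omega> = unity_root n"
  have \<omega>1: "\<omega> \<noteq> 1" using unity_root_power_eq_iff[OF n0, of 1 0] n1 by (simp add: \<omega>_def)
  \<comment> \<open>\<open>S m\<close> is the quotient of \<open>X^m - 1\<close> by
    \<open>X - 1\<close>. Its value \<open>m\<close> at 1 makes the drift appear in
    \<open>poly p 1\<close>.\<close>
  define S where "S m = (\<Sum>j<m. monom (1::complex) j)" for m
  define p where "p = (\<Sum>k\<in>set_mset \<Gamma>. smult (of_nat (count \<Gamma> k)) (S (x * k) - S (y * k)))"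
  have S: "(\<omega> - 1) * poly (S m) \<omega> = \<omega> ^ m - 1" for m
    using \<omega>1 by (simp add: S_def poly_sum poly_monom sum_gp_strict field_simps)
  have size: "size \<Gamma> \<noteq> 0" using drift by (auto simp: drift_def)
  have "0 = of_nat (size \<Gamma>) * (step_eigenvalue n \<Gamma> x - step_eigenvalue n \<Gamma> y)" using eq by simp
  also have "\<dots> = (\<Sum>k\<in>set_mset \<Gamma>. of_nat (count \<Gamma> k) * (\<omega> ^ (x * k) - \<omega> ^ (y * k)))"
    using size unfolding step_eigenvalue_def \<omega>_def sum_distrib_left sum_subtractf[symmetric]
    by (intro sum.cong refl) (simp add: step_prob_def field_simps)
  also have "\<dots> = (\<Sum>k\<in>set_mset \<Gamma>. of_nat (count \<Gamma> k) *
      ((\<omega> - 1) * poly (S (x * k)) \<omega> - (\<omega> - 1) * poly (S (y * k)) \<omega>))"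
    by (simp add: S)
  also have "\<dots> = (\<omega> - 1) * poly p \<omega>"
    by (simp add: p_def poly_sum sum_distrib_left algebra_simps)
  finally have "poly p \<omega> = 0" using \<omega>1 by simp
  moreover have "\<omega> ^ n = 1" using n0 by (simp add: \<omega>_def)
  moreover have "int_coeffs p" unfolding p_def S_def
    by (intro int_coeffs_sum int_coeffs_smult int_coeffs_diff int_coeffs_monom) auto
  moreover have "poly p 1 = of_int ((int x - int y) * int (sum_mset \<Gamma>))"
    by (simp add: p_def S_def poly_sum poly_monom sum_mset_nat_eq sum_distrib_left algebra_simps)
  ultimately have "int n dvd (int x - int y) * int (sum_mset \<Gamma>)"
    using prime_dvd_poly_1_if_root_of_unity[OF n] by blast
  moreover have "\<not> int n dvd int (sum_mset \<Gamma>)" unfolding int_dvd_int_iff using drift by (simp add: drift_def mod_eq_0_iff_dvd)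
  ultimately have "int n dvd int x - int y" using n by (simp add: prime_dvd_mult_iff)
  hence "[int x = int y] (mod int n)" by (simp add: cong_iff_dvd_diff)
  thus "x = y" using xy by (simp add: cong_int_iff cong_def)
qed

section \<open>The transition operator and observables of the label process\<close>

text \<open>Arguments are not reduced modulo \<open>n\<close>: the operator is applied to \<open>n\<close>-periodic functions.\<close>
definition walk_op :: "nat multiset \<Rightarrow> (nat \<Rightarrow> complex) \<Rightarrow> nat \<Rightarrow> complex" where
  "walk_op \<Gamma> u v = (\<Sum>k\<in>set_mset \<Gamma>. of_real (step_prob \<Gamma> k) * u (v + k))"

text \<open>The expectation of \<open>h\<^sub>1 (f (v(1))) \<cdots> h\<^sub>m (f (v(m)))\<close> for the walk started at \<open>v\<close>.\<close>
primrec observe :: "nat \<Rightarrow> nat multiset \<Rightarrow> (nat \<Rightarrow> bool) \<Rightarrow> (bool \<Rightarrow> complex) list \<Rightarrow> nat \<Rightarrow> complex" where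
  "observe n \<Gamma> f [] = (\<lambda>v. 1)"
| "observe n \<Gamma> f (h # hs) = (\<lambda>v. h (f (v mod n)) * walk_op \<Gamma> (observe n \<Gamma> f hs) v)"

lemma walk_op_one:
  assumes "\<Gamma> \<noteq> {#}" shows "walk_op \<Gamma> (\<lambda>v. 1) = (\<lambda>v. 1)"
proof
  fix v
  have "(\<Sum>k\<in>set_mset \<Gamma>. real (count \<Gamma> k)) = real (size \<Gamma>)"
    by (simp add: size_multiset_overloaded_eq)
  hence "(\<Sum>k\<in>set_mset \<Gamma>. step_prob \<Gamma> k) = 1"
    using assms by (simp add: step_prob_def flip: sum_divide_distrib)
  thus "walk_op \<Gamma> (\<lambda>v. 1) v = 1" by (simp add: walk_op_def flip: of_real_sum)
qed

lemma walk_op_linear: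
  "walk_op \<Gamma> (\<lambda>v. a * u v + b * w v) v = a * walk_op \<Gamma> u v + b * walk_op \<Gamma> w v"
  by (simp add: walk_op_def sum_distrib_left sum.distrib algebra_simps)

lemma path_prob_eq_observe:
  assumes "\<Gamma> \<noteq> {#}"
  shows "of_real (path_prob n \<Gamma> f (v mod n) w) = observe n \<Gamma> f (map (\<lambda>b c. of_bool (c = b)) w) v"
proof (induction w arbitrary: v)
  case (Cons b w)
  show ?case
  proof (cases w)
    \<comment> \<open>\<open>observe\<close> applies the operator once more after the last label,
      where \<open>path_prob\<close> stops; the extra step acts on the constant 1, which the
      operator fixes.\<close>
    case Nil
    thus ?thesis by (simp add: walk_op_one[OF assms])
  next
    case (Cons b' bs)
    have "of_real (path_prob n \<Gamma> f ((v mod n + k) mod n) w) =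
        observe n \<Gamma> f (map (\<lambda>b c. of_bool (c = b)) w) (v + k)" for k
      using Cons.IH[of "v + k"] by (simp add: mod_add_left_eq)
    thus ?thesis unfolding Cons by (simp add: walk_op_def)
  qed
qed simp

text \<open>A function on \<open>bool\<close> is a combination of two indicators, and
  \<open>observe\<close> is linear in each factor.\<close>

lemma observe_split:
  "observe n \<Gamma> f (hs @ h # hs') v =
    h True * observe n \<Gamma> f (hs @ (\<lambda>c. of_bool (c = True)) # hs') v +
    h False * observe n \<Gamma> f (hs @ (\<lambda>c. of_bool (c = False)) # hs') v"
proof (induction hs arbitrary: v)
  case Nil
  show ?case by simp
next
  case (Cons g hs)
  have "observe n \<Gamma> f (hs @ h # hs') = (\<lambda>v.
    h True * observe n \<Gamma> f (hs @ (\<lambda>c. of_bool (c = True)) # hs') v +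
    h False * observe n \<Gamma> f (hs @ (\<lambda>c. of_bool (c = False)) # hs') v)"
    using Cons.IH by (rule ext)
  thus ?case by (simp add: walk_op_linear algebra_simps)
qed

lemma same_label_distribution_observe:
  assumes same: "same_label_distribution n \<Gamma> f1 f2" and "\<Gamma> \<noteq> {#}" "n > 0"
  shows "(\<Sum>v<n. observe n \<Gamma> f1 hs v) = (\<Sum>v<n. observe n \<Gamma> f2 hs v)"
proof -
  have words: "(\<Sum>v<n. observe n \<Gamma> f (map (\<lambda>b c. of_bool (c = b)) w) v) = of_real (real n * word_prob n \<Gamma> f w)"
    for f w
  proof -
    have "(\<Sum>v<n. observe n \<Gamma> f (map (\<lambda>b c. of_bool (c = b)) w) v) = of_real (\<Sum>v<n. path_prob n \<Gamma> f v w)"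
      unfolding path_prob_eq_observe[OF assms(2), symmetric] of_real_sum by (intro sum.cong) auto
    thus ?thesis using assms(3) by (simp add: word_prob_def flip: sum_divide_distrib)
  qed
  \<comment> \<open>The prefix \<open>w\<close> collects the factors already expanded into
    indicators; once all are expanded, only word probabilities remain.\<close>
  have "(\<Sum>v<n. observe n \<Gamma> f1 (map (\<lambda>b c. of_bool (c = b)) w @ hs) v) =
      (\<Sum>v<n. observe n \<Gamma> f2 (map (\<lambda>b c. of_bool (c = b)) w @ hs) v)" for w
  proof (induction hs arbitrary: w)
    case Nil
    show ?case using same by (simp add: words same_label_distribution_def)
  next
    case (Cons h hs)
    show ?case
      unfolding observe_split[of n \<Gamma> _ _ h] sum.distrib sum_distrib_left[symmetric]
      using Cons.IH[of "w @ [True]"] Cons.IH[of "w @ [False]"] by simp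
  qed
  from this[of "[]"] show ?thesis by simp
qed

text \<open>A constant factor 1 ignores the label at that time, so waiting \<open>t\<close> steps is
  itself an observable.\<close>

lemma observe_constant_prefix:
  "observe n \<Gamma> f (replicate t (\<lambda>_. 1) @ hs) = (walk_op \<Gamma> ^^ t) (observe n \<Gamma> f hs)"
  by (induction t) auto

text \<open>A delay of \<open>0\<close> is harmless because a labeling is idempotent under multiplication.\<close>
lemma observe_delay:
  "\<exists>hs'. \<forall>f. observe n \<Gamma> f (of_bool # hs') =
     (\<lambda>v. of_bool (f (v mod n)) * (walk_op \<Gamma> ^^ t) (observe n \<Gamma> f (of_bool # hs)) v)"
proof (cases t)
  case 0
  thus ?thesis by (intro exI[of _ hs]) auto
next
  case (Suc s)
  thus ?thesis
    by (intro exI[of _ "replicate s (\<lambda>_. 1) @ of_bool # hs"]) (simp add: observe_constant_prefix)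
qed

section \<open>Triple correlations and the bispectrum\<close>

text \<open>For nonempty \<open>\<Gamma>\<close> this is \<open>n\<close> times the expected product
  of the 0/1 labels at times \<open>1\<close>, \<open>1 + t\<close> and
  \<open>1 + t + s\<close>.\<close>

definition triple_correlation :: "nat \<Rightarrow> nat multiset \<Rightarrow> (nat \<Rightarrow> bool) \<Rightarrow> nat \<Rightarrow> nat \<Rightarrow> complex" where
  "triple_correlation n \<Gamma> f t s =
    (\<Sum>v<n. of_bool (f (v mod n)) * (walk_op \<Gamma> ^^ t) (\<lambda>v. of_bool (f (v mod n)) *
       (walk_op \<Gamma> ^^ s) (\<lambda>v. of_bool (f (v mod n))) v) v)"

text \<open>Both delays are encoded in one list of observables that does not depend on the labeling,
  so it can be compared for \<open>f1\<close> and \<open>f2\<close>.\<close>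

lemma same_label_distribution_triple_correlation:
  assumes "same_label_distribution n \<Gamma> f1 f2" and "\<Gamma> \<noteq> {#}" "n > 0"
  shows "triple_correlation n \<Gamma> f1 t s = triple_correlation n \<Gamma> f2 t s"
proof -
  have one: "observe n \<Gamma> f [of_bool] = (\<lambda>v. of_bool (f (v mod n)))" for f
    by (simp add: walk_op_one[OF assms(2)])
  obtain hs where hs: "\<And>f. observe n \<Gamma> f (of_bool # hs) =
      (\<lambda>v. of_bool (f (v mod n)) * (walk_op \<Gamma> ^^ s) (\<lambda>v. of_bool (f (v mod n))) v)"
    using observe_delay[of n \<Gamma> s "[]"] unfolding one by blast
  obtain hs' where "\<And>f. observe n \<Gamma> f (of_bool # hs') =
      (\<lambda>v. of_bool (f (v mod n)) * (walk_op \<Gamma> ^^ t) (observe n \<Gamma> f (of_bool # hs)) v)"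
    using observe_delay[of n \<Gamma> t hs] by blast
  hence "triple_correlation n \<Gamma> f t s = (\<Sum>v<n. observe n \<Gamma> f (of_bool # hs') v)" for f
    by (simp only: triple_correlation_def hs)
  thus ?thesis using same_label_distribution_observe[OF assms] by (simp only:)
qed

text \<open>Each character is an eigenfunction. The index set and the frequencies \<open>e\<close>
  are arbitrary so that sums over pairs, with frequency \<open>y + z\<close>, are covered as
  well.\<close>

lemma walk_op_power_trigonometric:
  "(walk_op \<Gamma> ^^ t) (\<lambda>v. \<Sum>i\<in>I. c i * unity_root n ^ (e i * v)) =
    (\<lambda>v. \<Sum>i\<in>I. c i * step_eigenvalue n \<Gamma> (e i) ^ t * unity_root n ^ (e i * v))"
proof (induction t)
  case (Suc t)
  have "walk_op \<Gamma> (\<lambda>v. \<Sum>i\<in>I. c i * step_eigenvalue n \<Gamma> (e i) ^ t * unity_root n ^ (e i * v)) v =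
    (\<Sum>i\<in>I. c i * step_eigenvalue n \<Gamma> (e i) ^ Suc t * unity_root n ^ (e i * v))" for v
    unfolding walk_op_def step_eigenvalue_def[of n \<Gamma> "e _"] power_Suc sum_distrib_left sum_distrib_right
    by (subst sum.swap) (simp add: mult_ac power_add distrib_left)
  thus ?case using Suc.IH by auto
qed auto

lemma sum_labeling_unity_root:
  assumes "n > 0"
  shows "(\<Sum>v<n. of_bool (f (v mod n)) * unity_root n ^ (x * v)) = of_nat n * cnj (fourier_coeff n f x)"
  using assms by (simp add: fourier_coeff_def)

text \<open>The sum is nested for two Vandermonde arguments: the outer one has nodes indexed by
  \<open>y\<close> and exponent \<open>s\<close>, the inner one nodes indexed by
  \<open>y + z\<close> and exponent \<open>t\<close>.\<close>

lemma triple_correlation_eq: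
  assumes n: "n > 0"
  shows "triple_correlation n \<Gamma> f t s = of_nat n * (\<Sum>y<n. (\<Sum>z<n.
    (fourier_coeff n f y * fourier_coeff n f z * cnj (fourier_coeff n f (y + z)))
      * step_eigenvalue n \<Gamma> (y + z) ^ t) * step_eigenvalue n \<Gamma> y ^ s)"
proof -
  define a where "a = fourier_coeff n f"
  define g where "g = step_eigenvalue n \<Gamma>"
  define \<omega> where "\<omega> = unity_root n"
  have 1: "(walk_op \<Gamma> ^^ s) (\<lambda>v. of_bool (f (v mod n))) = (\<lambda>v. \<Sum>y<n. a y * g y ^ s * \<omega> ^ (y * v))"
    unfolding fourier_inversion[OF n] a_def g_def \<omega>_def by (rule walk_op_power_trigonometric)
  \<comment> \<open>Multiplication by the labeling adds frequencies, so the product is again a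
    trigonometric sum, now over pairs.\<close>
  have 2: "(\<lambda>v. of_bool (f (v mod n)) * (walk_op \<Gamma> ^^ s) (\<lambda>v. of_bool (f (v mod n))) v) =
    (\<lambda>v. \<Sum>(y,z)\<in>{..<n}\<times>{..<n}. (a y * a z * g y ^ s) * \<omega> ^ ((y + z) * v))"
  proof
    fix v
    have "of_bool (f (v mod n)) * (walk_op \<Gamma> ^^ s) (\<lambda>v. of_bool (f (v mod n))) v =
        (\<Sum>y<n. a y * g y ^ s * \<omega> ^ (y * v)) * (\<Sum>z<n. a z * \<omega> ^ (z * v))"
      unfolding 1 unfolding fourier_inversion[OF n] a_def \<omega>_def by (rule mult.commute)
    thus "of_bool (f (v mod n)) * (walk_op \<Gamma> ^^ s) (\<lambda>v. of_bool (f (v mod n))) v =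
        (\<Sum>(y,z)\<in>{..<n}\<times>{..<n}. (a y * a z * g y ^ s) * \<omega> ^ ((y + z) * v))"
      unfolding sum_product sum.cartesian_product by (simp add: power_add algebra_simps)
  qed
  have 3: "(walk_op \<Gamma> ^^ t) (\<lambda>v. of_bool (f (v mod n)) * (walk_op \<Gamma> ^^ s) (\<lambda>v. of_bool (f (v mod n))) v) =
    (\<lambda>v. \<Sum>(y,z)\<in>{..<n}\<times>{..<n}. (a y * a z * g y ^ s) * g (y + z) ^ t * \<omega> ^ ((y + z) * v))"
    unfolding 2 case_prod_unfold g_def \<omega>_def by (rule walk_op_power_trigonometric)
  have "triple_correlation n \<Gamma> f t s =
    (\<Sum>v<n. \<Sum>(y,z)\<in>{..<n}\<times>{..<n}. (a y * a z * g y ^ s * g (y + z) ^ t) *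
      (of_bool (f (v mod n)) * \<omega> ^ ((y + z) * v)))"
    unfolding triple_correlation_def 3 sum_distrib_left by (simp add: case_prod_unfold mult_ac)
  also have "\<dots> = (\<Sum>(y,z)\<in>{..<n}\<times>{..<n}. (a y * a z * g y ^ s * g (y + z) ^ t) *
      (\<Sum>v<n. of_bool (f (v mod n)) * \<omega> ^ ((y + z) * v)))"
    unfolding sum_distrib_left by (subst sum.swap) (simp add: case_prod_unfold)
  also have "\<dots> = (\<Sum>(y,z)\<in>{..<n}\<times>{..<n}. (a y * a z * g y ^ s * g (y + z) ^ t) *
      (of_nat n * cnj (a (y + z))))"
    unfolding \<omega>_def sum_labeling_unity_root[OF n] a_def ..
  finally show ?thesis
    by (simp add: sum_distrib_left sum_distrib_right sum.cartesian_product case_prod_unfold mult_ac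
        flip: a_def g_def)
qed

lemma same_label_distribution_bispectrum:
  assumes same: "same_label_distribution n \<Gamma> f1 f2" and "\<Gamma> \<noteq> {#}" and n: "n > 0"
    and inj: "inj_on (step_eigenvalue n \<Gamma>) {..<n}"
    and y: "y < n" and z: "z < n"
  shows "fourier_coeff n f1 y * fourier_coeff n f1 z * cnj (fourier_coeff n f1 (y + z)) =
    fourier_coeff n f2 y * fourier_coeff n f2 z * cnj (fourier_coeff n f2 (y + z))"
proof -
  define b where "b f y z = fourier_coeff n f y * fourier_coeff n f z * cnj (fourier_coeff n f (y + z))" for f y z
  define g where "g = step_eigenvalue n \<Gamma>"
  define d where "d y z = b f1 y z - b f2 y z" for y z
  have "(\<Sum>y<n. (\<Sum>z<n. b f1 y z * g (y + z) ^ t) * g y ^ s) =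
      (\<Sum>y<n. (\<Sum>z<n. b f2 y z * g (y + z) ^ t) * g y ^ s)" for s t
    using same_label_distribution_triple_correlation[OF same assms(2) n, of t s] n
    unfolding triple_correlation_eq[OF n] b_def g_def by simp
  hence "(\<Sum>y<n. (\<Sum>z<n. d y z * g (y + z) ^ t) * g y ^ s) = 0" for s t
    by (simp add: d_def left_diff_distrib sum_subtractf)
  \<comment> \<open>Letting \<open>s\<close> vary isolates \<open>y\<close>; letting
    \<open>t\<close> vary will then isolate \<open>z\<close>.\<close>
  hence "(\<Sum>z<n. d y z * g (y + z) ^ t) = 0" for t
    using vandermonde_kernel_trivial[of "{..<n}" g "\<lambda>y. \<Sum>z<n. d y z * g (y + z) ^ t" y] inj y
    unfolding g_def by blast
  \<comment> \<open>Translation by \<open>y\<close> permutes the residues, so the translated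
    eigenvalues are still distinct.\<close>
  moreover have "inj_on (\<lambda>z. g (y + z)) {..<n}"
  proof (rule inj_onI)
    fix z z' assume *: "z \<in> {..<n}" "z' \<in> {..<n}" "g (y + z) = g (y + z')"
    have "g (x mod n) = g x" for x
      unfolding g_def by (rule step_eigenvalue_cong[OF n]) simp
    hence "g ((y + z) mod n) = g ((y + z') mod n)" using *(3) by simp
    hence "(y + z) mod n = (y + z') mod n" using n by (intro inj_onD[OF inj]) (auto simp: g_def)
    hence "[y + z = y + z'] (mod n)" by (simp add: cong_def)
    hence "[z = z'] (mod n)" by (simp only: cong_add_lcancel_nat)
    thus "z = z'" using * by (simp add: cong_def)
  qed
  ultimately have "d y z = 0"
    using vandermonde_kernel_trivial[of "{..<n}" "\<lambda>z. g (y + z)" "d y" z] z by blast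
  thus ?thesis by (simp add: d_def b_def)
qed

section \<open>From the bispectrum to the shift\<close>

lemma shift_if_fourier_modulated:
  assumes n: "n > 0" and eq: "\<And>x. x < n \<Longrightarrow> fourier_coeff n f1 x = unity_root n ^ (l * x) * fourier_coeff n f2 x"
  shows "f1 (k mod n) = f2 ((k + l) mod n)"
proof -
  have "of_bool (f1 (k mod n)) = (of_bool (f2 ((k + l) mod n)) :: complex)"
    unfolding fourier_inversion[OF n] by (intro sum.cong refl) (simp add: eq power_add algebra_simps)
  thus ?thesis by (simp only: of_bool_eq_iff)
qed

lemma constant_labeling_fourier:
  assumes "n > 0" and "\<And>k. k < n \<Longrightarrow> f k" and "0 < x" "x < n"
  shows "fourier_coeff n f x = 0"
proof -
  have "(\<Sum>k<n. unity_root n ^ (k * 0) * cnj (unity_root n) ^ (k * x)) = (0 :: complex)"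
    using assms by (subst sum_unity_root_orthogonal) auto
  thus ?thesis using assms(2) by (simp add: fourier_coeff_def mult.commute)
qed

theorem theorem3:
  fixes n :: nat and \<Gamma> :: "nat multiset"
  assumes "prime n" and "n > 5"
    and "set_mset \<Gamma> \<subseteq> {..<n}"
    and "drift n \<Gamma> \<noteq> 0"
  shows "reconstructive n \<Gamma>"
  unfolding reconstructive_def
proof (intro allI impI)
  fix f1 f2 assume same: "same_label_distribution n \<Gamma> f1 f2"
  define a1 where "a1 = fourier_coeff n f1"
  define a2 where "a2 = fourier_coeff n f2"
  have n: "n > 0" using assms by simp
  have "\<Gamma> \<noteq> {#}" using assms(4) by (auto simp: drift_def)
  hence bispectrum: "a1 y * a1 z * cnj (a1 (y + z)) = a2 y * a2 z * cnj (a2 (y + z))"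
    if "y < n" "z < n" for y z
    unfolding a1_def a2_def
    by (intro same_label_distribution_bispectrum[OF same] n inj_on_step_eigenvalue assms that)
  define m1 where "m1 = real (card {k. k < n \<and> f1 k}) / real n"
  define m2 where "m2 = real (card {k. k < n \<and> f2 k}) / real n"
  have mean: "a1 0 = of_real m1" "a2 0 = of_real m2"
    unfolding a1_def a2_def m1_def m2_def by (rule fourier_coeff_0)+
  \<comment> \<open>The means are real, so the bispectrum at (0, 0) is the cube of the mean.\<close>
  have "m1 ^ 3 = m2 ^ 3"
    using bispectrum[of 0 0] n
    by (simp add: mean power3_eq_cube del: of_real_mult flip: of_real_mult)
  moreover have "m1 \<ge> 0" "m2 \<ge> 0" by (auto simp: m1_def m2_def)
  ultimately have m_eq: "m1 = m2" by (simp add: power_eq_iff_eq_base)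
  \<comment> \<open>At \<open>(x, 0)\<close> the bispectrum is the squared modulus at
    \<open>x\<close> times the mean.\<close>
  have modulus: "cmod (a1 x) = cmod (a2 x)" if "x < n" "m1 \<noteq> 0" for x
  proof -
    have "(a1 x * cnj (a1 x)) * m1 = (a2 x * cnj (a2 x)) * m1"
      using bispectrum[of x 0] that n by (simp add: mean m_eq mult_ac)
    hence "a1 x * cnj (a1 x) = a2 x * cnj (a2 x)" using that by simp
    hence "(cmod (a1 x))\<^sup>2 = (cmod (a2 x))\<^sup>2"
      by (metis complex_norm_square of_real_eq_iff)
    thus ?thesis by simp
  qed
  have shift: "\<exists>l<n. \<forall>k<n. f1 k = f2 ((k + l) mod n)"
    if "l < n" "\<And>x. x < n \<Longrightarrow> a1 x = unity_root n ^ (l * x) * a2 x" for l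
    using shift_if_fourier_modulated[OF n, of f1 l f2] that unfolding a1_def a2_def
    by (metis mod_less)
  \<comment> \<open>The cases are: \<open>f1\<close> is identically false; it is identically true,
    since a coefficient vanishes; or every coefficient can be divided by.\<close>
  consider "m1 = 0" | "m1 \<noteq> 0" "\<exists>x<n. a1 x = 0" | "m1 \<noteq> 0" "\<And>x. x < n \<Longrightarrow> a1 x \<noteq> 0" by blast
  thus "\<exists>l<n. \<forall>k<n. f1 k = f2 ((k + l) mod n)"
  proof cases
    case 1
    hence "m2 = 0" using m_eq by simp
    hence "\<forall>k<n. \<not> f1 k" "\<forall>k<n. \<not> f2 k" using 1 n by (auto simp: m1_def m2_def)
    thus ?thesis using n by auto
  next
    case 2
    have "\<not> (\<forall>k<n. \<not> f1 k)" using 2(1) by (auto simp: m1_def)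
    hence "\<forall>k<n. f1 k"
      using 2(2) fourier_coeff_eq_0_imp_constant[OF assms(1)] unfolding a1_def by blast
    hence a1: "a1 x = 0" if "x < n" "x > 0" for x
      using constant_labeling_fourier that n by (simp add: a1_def)
    \<comment> \<open>Equal moduli force \<open>a2\<close> to vanish off 0 too, and the means agree,
      so the shift is 0.\<close>
    have "a1 x = a2 x" if "x < n" for x
      using modulus[OF that 2(1)] a1[OF that] mean m_eq by (cases "x = 0") auto
    thus ?thesis using n by (intro shift[of 0]) auto
  next
    case 3
    define q where "q x = a1 x / a2 x" for x
    have a2: "a2 x \<noteq> 0" if "x < n" for x using 3 modulus that by fastforce
    have a_mod: "a1 (x mod n) = a1 x" "a2 (x mod n) = a2 x" for x
      using n by (simp_all add: a1_def a2_def fourier_coeff_mod)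
    have nz: "a1 x \<noteq> 0" "a2 x \<noteq> 0" for x
      using 3(2)[of "x mod n"] a2[of "x mod n"] n by (simp_all add: a_mod)
    \<comment> \<open>Since \<open>q\<close> has modulus 1, its conjugate is its inverse; this turns
      equality of bispectra into multiplicativity of \<open>q\<close>.\<close>
    have q_norm: "q x * cnj (q x) = 1" for x
      using modulus[of "x mod n"] 3(1) n nz[of x]
      by (simp add: a_mod q_def norm_divide flip: complex_norm_square)
    have q_add: "q (y + z) = q y * q z" if "y < n" "z < n" for y z
    proof -
      have "q y * q z * cnj (q (y + z)) = 1"
        using bispectrum[OF that] nz by (simp add: q_def field_simps)
      hence "q y * q z * (q (y + z) * cnj (q (y + z))) = q (y + z)"
        by (simp add: mult_ac)
      thus ?thesis by (simp add: q_norm)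
    qed
    have q0: "q 0 = 1" using 3(1) m_eq by (simp add: q_def mean)
    \<comment> \<open>The range includes \<open>n\<close> itself: periodicity
      \<open>q n = q 0\<close> then makes \<open>q 1\<close> an \<open>n\<close>-th root of unity,
      whose exponent is the shift.\<close>
    have q_power: "q x = q 1 ^ x" if "x \<le> n" for x
      using that
    proof (induction x)
      case (Suc x)
      thus ?case using q_add[of x 1] assms(2) by simp
    qed (simp add: q0)
    have "q n = q 0" using a_mod[of n] by (simp add: q_def)
    hence "q 1 ^ n = 1" using q_power[of n] q0 by simp
    then obtain l where l: "l < n" "q 1 = unity_root n ^ l" using root_of_unity_cases[OF n] by blast
    have "a1 x = unity_root n ^ (l * x) * a2 x" if "x < n" for x
    proof -
      have "q x = unity_root n ^ (l * x)" using q_power[of x] that by (simp only: l(2) power_mult less_imp_le)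
      thus ?thesis using nz[of x] by (simp add: q_def field_simps)
    qed
    thus ?thesis using l(1) by (intro shift)
  qed
qed

end
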